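(* Let $\hat p:(0,\infty)\to(0,\infty)$ be smooth with $\hat p'>0$ and with inverse $\hat\rho:(0,\infty)\to(0,\infty)$, $\hat\rho'>0$ (so $\hat p\circ\hat\rho=\hat\rho\circ\hat p=\mathrm{id}_{(0,\infty)}$). Consider a barotropic perfect fluid with energy $\rho>0$, pressure $p=\hat p(\rho)$, Lichnerowicz index $f=\hat f(p)$, conjugate index $\nu=\hat\nu(\rho)$ and 4-velocity $U^\alpha$. For smooth solutions, the barotropic Euler equations $$T^{\alpha\beta}{}_{,\beta}=0,\qquad T^{\alpha\beta}=\rho\, U^\alpha U^\beta+p\,\Pi^{\alpha\beta},$$ are equivalent to the pair consisting of the companion law $$(\nu U^\beta)_{,\beta}=0$$ and the equations of motion $$U^\beta\big(fU^\alpha\big)_{,\beta}+f^{,\alpha}=0 .$$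
   Context: Space-time is Minkowski space with metric $g=\mathrm{diag}(-1,1,1,1)$; Greek indices run over $0,1,2,3$, are raised and lowered with $g$, repeated indices are summed, and $_{,\beta}$ denotes $\partial/\partial x^\beta$. The 4-velocity satisfies $U^\alpha U_\alpha=-1$, and $\Pi^{\alpha\beta}=g^{\alpha\beta}+U^\alpha U^\beta$ is the projection orthogonal to $U$. The Lichnerowicz index and its conjugate index are the functions of state $$f=\hat f(p)=\exp\int_1^{p}\frac{dp'}{\hat\rho(p')+p'},\qquad \nu=\hat\nu(\rho)=\exp\int_1^{\rho}\frac{d\rho'}{\rho'+\hat p(\rho')} .$$ Any one of $\rho,p,f,\nu$ determines the other three. The unknowns are the smooth fields $\rho$ (equivalently $p$, $f$ or $\nu$) and $U^\alpha$. *)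

theory Defs
  imports "HOL-Analysis.Analysis"
begin

text \<open>Smoothness on an open set: existence and continuity of the iterated (Frechet)
  derivatives of all orders.\<close>

primrec Ck_on :: "nat \<Rightarrow> 'a::real_normed_vector set \<Rightarrow> ('a \<Rightarrow> 'b::real_normed_vector) \<Rightarrow> bool" where
  "Ck_on 0 S F \<longleftrightarrow> continuous_on S F"
| "Ck_on (Suc k) S F \<longleftrightarrow> (\<forall>x\<in>S. F differentiable (at x)) \<and>
     (\<forall>v. Ck_on k S (\<lambda>x. frechet_derivative F (at x) v))"

definition smooth_on :: "'a::euclidean_space set \<Rightarrow> ('a \<Rightarrow> 'b::real_normed_vector) \<Rightarrow> bool" where
  "smooth_on S F \<longleftrightarrow> (\<forall>k. Ck_on k S F)"

text \<open>Coordinates are indexed by the four-element type \<open>4\<close>, with elements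
  \<open>0, 1, 2, 3\<close>; the time index is \<open>0\<close>, which in this type is the same element as the
  numeral \<open>4\<close>. The matrix of the metric is its own inverse, so \<open>minkowski\<close> serves both
  with lowered and with raised indices.\<close>

type_synonym spacetime = "real ^ 4"

definition minkowski :: "4 \<Rightarrow> 4 \<Rightarrow> real" where
  "minkowski \<alpha> \<beta> = (if \<alpha> = \<beta> then (if \<alpha> = 0 then -1 else 1) else 0)"

definition lower :: "real ^ 4 \<Rightarrow> 4 \<Rightarrow> real" where
  "lower V \<alpha> = (\<Sum>\<beta>\<in>UNIV. minkowski \<alpha> \<beta> * V $ \<beta>)"

definition partial :: "4 \<Rightarrow> (spacetime \<Rightarrow> real) \<Rightarrow> spacetime \<Rightarrow> real" where
  "partial \<beta> F x = deriv (\<lambda>t. F (x + t *\<^sub>R axis \<beta> 1)) 0"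

definition partial_up :: "4 \<Rightarrow> (spacetime \<Rightarrow> real) \<Rightarrow> spacetime \<Rightarrow> real" where
  "partial_up \<alpha> F x = (\<Sum>\<beta>\<in>UNIV. minkowski \<alpha> \<beta> * partial \<beta> F x)"

definition proj :: "real ^ 4 \<Rightarrow> 4 \<Rightarrow> 4 \<Rightarrow> real" where
  "proj V \<alpha> \<beta> = minkowski \<alpha> \<beta> + V $ \<alpha> * V $ \<beta>"

definition stress_energy ::
    "(spacetime \<Rightarrow> real) \<Rightarrow> (spacetime \<Rightarrow> real) \<Rightarrow> (spacetime \<Rightarrow> real ^ 4) \<Rightarrow> 4 \<Rightarrow> 4 \<Rightarrow> spacetime \<Rightarrow> real" where
  "stress_energy \<rho> p U \<alpha> \<beta> x = \<rho> x * U x $ \<alpha> * U x $ \<beta> + p x * proj (U x) \<alpha> \<beta>"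

text \<open>The interval integral is oriented, as needed for arguments below \<open>1\<close>.\<close>

definition lichnerowicz_index :: "(real \<Rightarrow> real) \<Rightarrow> real \<Rightarrow> real" where
  "lichnerowicz_index rhohat p = exp (LBINT q = ereal 1..ereal p. 1 / (rhohat q + q))"

definition conjugate_index :: "(real \<Rightarrow> real) \<Rightarrow> real \<Rightarrow> real" where
  "conjugate_index phat \<rho> = exp (LBINT r = ereal 1..ereal \<rho>. 1 / (r + phat r))"

end

theory Submission
  imports Defs
begin

text \<open>Write \<open>h = \<rho> + p\<close>. The indices are chosen so that \<open>f' = f / h\<close> and \<open>\<nu>' = \<nu> / h\<close>. Hence
  the companion law is \<open>\<nu> / h\<close> times \<open>U\<^sup>\<beta> \<rho>\<^sub>,\<^sub>\<beta> + h U\<^sup>\<beta>\<^sub>,\<^sub>\<beta>\<close>, and the divergence of the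
  stress-energy tensor is this scalar times \<open>U\<^sup>\<alpha>\<close> plus \<open>h / f\<close> times the left-hand side of the
  equations of motion. The latter is orthogonal to \<open>U\<close>, so contracting with \<open>U\<^sub>\<alpha>\<close> separates the
  two.\<close>

lemma smooth_on_imp_has_derivative:
  assumes "smooth_on S F" "x \<in> S"
  shows "(F has_derivative frechet_derivative F (at x)) (at x)"
proof -
  have "Ck_on (Suc 0) S F"
    using assms(1) unfolding smooth_on_def by blast
  then show ?thesis
    using assms(2) by (simp add: frechet_derivative_works)
qed

text \<open>\<open>partial\<close> is built on \<open>deriv\<close>, a choice operator whose value
  means something only for a differentiable function. Tying it to a Frechet derivative makes the
  product and chain rules available for every partial derivative below.\<close>

lemma partial_eq_derivative:
  assumes "(F has_derivative F') (at x)"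
  shows "partial \<beta> F x = F' (axis \<beta> 1)"
proof -
  interpret F': bounded_linear F'
    using assms by (rule has_derivative_bounded_linear)
  have "((\<lambda>t. x + t *\<^sub>R axis \<beta> 1) has_derivative (\<lambda>t. t *\<^sub>R axis \<beta> 1)) (at 0)"
    by (auto intro!: derivative_eq_intros)
  then have "((\<lambda>t. F (x + t *\<^sub>R axis \<beta> 1)) has_derivative (\<lambda>t. F' (t *\<^sub>R axis \<beta> 1))) (at 0)"
    by (rule has_derivative_compose) (use assms in simp)
  then have "((\<lambda>t. F (x + t *\<^sub>R axis \<beta> 1)) has_field_derivative F' (axis \<beta> 1)) (at 0)"
    by (simp add: has_field_derivative_def F'.scaleR mult_commute_abs)
  then show ?thesis
    unfolding partial_def by (rule DERIV_imp_deriv)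
qed

lemma DERIV_exp_interval_integral:
  fixes g :: "real \<Rightarrow> real"
  assumes "continuous_on {0<..} g" "x > 0"
  shows "((\<lambda>u. exp (LBINT y = ereal 1..ereal u. g y)) has_field_derivative
    exp (LBINT y = ereal 1..ereal x. g y) * g x) (at x)"
proof -
  \<comment> \<open>A compact interval inside the positive axis that contains the base point 1 and
    has \<open>x\<close> in its interior. The fundamental theorem applies on it whether
    \<open>x\<close> lies below or above 1, and the derivative within it is the full derivative at
    \<open>x\<close>.\<close>
  define a b where "a = min 1 x / 2" and "b = max 1 x + 1"
  have ab: "0 < a" "a \<le> 1" "1 \<le> b" "a < x" "x < b"
    using assms(2) by (auto simp: a_def b_def min_def)
  have "continuous_on {a..b} g"
    using ab(1) by (intro continuous_on_subset[OF assms(1)]) auto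
  then have "((\<lambda>u. LBINT y = ereal 1..ereal u. g y) has_vector_derivative g x) (at x within {a..b})"
    using ab by (intro interval_integral_FTC2) auto
  then have "((\<lambda>u. LBINT y = ereal 1..ereal u. g y) has_field_derivative g x) (at x)"
    using ab by (simp add: has_real_derivative_iff_has_vector_derivative at_within_Icc_at)
  from DERIV_fun_exp[OF this] show ?thesis .
qed

lemma lower_eq: "lower V \<alpha> = minkowski \<alpha> \<alpha> * V $ \<alpha>"
  unfolding lower_def minkowski_def by (simp add: if_distrib[of "\<lambda>c. c * _"] cong: if_cong)

lemma sum_minkowski: "(\<Sum>\<beta>\<in>UNIV. minkowski \<alpha> \<beta> * P \<beta>) = minkowski \<alpha> \<alpha> * P \<alpha>"
  unfolding minkowski_def by (simp add: if_distrib[of "\<lambda>c. c * _"] cong: if_cong)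

lemma minkowski_square: "minkowski \<alpha> \<alpha> * minkowski \<alpha> \<alpha> = 1"
  by (simp add: minkowski_def)

text \<open>The statement at a single event: \<open>R\<close> and \<open>P\<close> are the gradients of \<open>\<rho>\<close> and \<open>p\<close>, and
  \<open>W \<alpha> \<beta>\<close> stands for \<open>U\<^sup>\<alpha>\<^sub>,\<^sub>\<beta>\<close>.\<close>

lemma euler_iff_companion_and_motion_at_event:
  fixes u :: "real ^ 4" and R P :: "4 \<Rightarrow> real" and W :: "4 \<Rightarrow> 4 \<Rightarrow> real" and h f \<nu> :: real
  assumes unit: "(\<Sum>\<alpha>\<in>UNIV. lower u \<alpha> * u $ \<alpha>) = -1"
    and orth: "\<And>\<beta>. (\<Sum>\<alpha>\<in>UNIV. lower u \<alpha> * W \<alpha> \<beta>) = 0"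
    and pos: "h > 0" "f > 0" "\<nu> > 0"
  shows "(\<forall>\<alpha>. (\<Sum>\<beta>\<in>UNIV. (R \<beta> + P \<beta>) * u $ \<alpha> * u $ \<beta> + h * (W \<alpha> \<beta> * u $ \<beta> + u $ \<alpha> * W \<beta> \<beta>)
        + minkowski \<alpha> \<beta> * P \<beta>) = 0) \<longleftrightarrow>
    (\<Sum>\<beta>\<in>UNIV. \<nu> / h * R \<beta> * u $ \<beta> + \<nu> * W \<beta> \<beta>) = 0 \<and>
    (\<forall>\<alpha>. (\<Sum>\<beta>\<in>UNIV. u $ \<beta> * (f / h * P \<beta> * u $ \<alpha> + f * W \<alpha> \<beta>))
        + (\<Sum>\<beta>\<in>UNIV. minkowski \<alpha> \<beta> * (f / h * P \<beta>)) = 0)"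
    (is "(\<forall>\<alpha>. ?E \<alpha> = 0) \<longleftrightarrow> ?C = 0 \<and> (\<forall>\<alpha>. ?M \<alpha> = 0)")
proof -
  \<comment> \<open>\<open>S\<close> is the energy balance, \<open>Q\<close> the derivative of the
    pressure along \<open>u\<close>, and \<open>A\<close> the acceleration. \<open>G\<close> is the
    momentum balance: \<open>h\<close> times the acceleration plus the pressure gradient projected
    orthogonally to \<open>u\<close>.\<close>
  define S where "S = (\<Sum>\<beta>\<in>UNIV. R \<beta> * u $ \<beta>) + h * (\<Sum>\<beta>\<in>UNIV. W \<beta> \<beta>)"
  define Q where "Q = (\<Sum>\<beta>\<in>UNIV. P \<beta> * u $ \<beta>)"
  define A where "A \<alpha> = (\<Sum>\<beta>\<in>UNIV. W \<alpha> \<beta> * u $ \<beta>)" for \<alpha>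
  define G where "G \<alpha> = Q * u $ \<alpha> + h * A \<alpha> + minkowski \<alpha> \<alpha> * P \<alpha>" for \<alpha>
  have E: "?E \<alpha> = S * u $ \<alpha> + G \<alpha>" for \<alpha>
    unfolding S_def G_def Q_def A_def sum.distrib sum_minkowski
    by (simp add: sum.distrib distrib_left distrib_right
        sum_distrib_left sum_distrib_right mult_ac)
  have C: "?C = \<nu> / h * S"
    using pos unfolding S_def
    by (simp add: sum.distrib distrib_left sum_distrib_left mult_ac)
  have M: "?M \<alpha> = f / h * G \<alpha>" for \<alpha>
    using pos unfolding G_def Q_def A_def sum_minkowski
    by (simp add: sum.distrib distrib_left sum_distrib_left sum_distrib_right mult_ac)
  have "(\<Sum>\<alpha>\<in>UNIV. lower u \<alpha> * A \<alpha>) = (\<Sum>\<beta>\<in>UNIV. (\<Sum>\<alpha>\<in>UNIV. lower u \<alpha> * W \<alpha> \<beta>) * u $ \<beta>)"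
    unfolding A_def sum_distrib_left sum_distrib_right
    by (subst sum.swap) (simp add: mult_ac)
  then have A0: "(\<Sum>\<alpha>\<in>UNIV. lower u \<alpha> * A \<alpha>) = 0"
    by (simp add: orth)
  \<comment> \<open>One metric factor lowers the index of \<open>u\<close>, the other raises that of
    the gradient; together they cancel.\<close>
  have "lower u \<alpha> * (minkowski \<alpha> \<alpha> * P \<alpha>) = P \<alpha> * u $ \<alpha>" for \<alpha>
  proof -
    have "lower u \<alpha> * (minkowski \<alpha> \<alpha> * P \<alpha>) = minkowski \<alpha> \<alpha> * minkowski \<alpha> \<alpha> * (P \<alpha> * u $ \<alpha>)"
      by (simp add: lower_eq)
    then show ?thesis
      by (simp add: minkowski_square)
  qed
  then have PQ: "(\<Sum>\<alpha>\<in>UNIV. lower u \<alpha> * (minkowski \<alpha> \<alpha> * P \<alpha>)) = Q"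
    unfolding Q_def by (intro sum.cong refl)
  \<comment> \<open>The three terms contract to \<open>-Q\<close>, 0 and \<open>Q\<close>, so
    \<open>G\<close> is orthogonal to \<open>u\<close>.\<close>
  have "(\<Sum>\<alpha>\<in>UNIV. lower u \<alpha> * G \<alpha>) = Q * (\<Sum>\<alpha>\<in>UNIV. lower u \<alpha> * u $ \<alpha>)
      + h * (\<Sum>\<alpha>\<in>UNIV. lower u \<alpha> * A \<alpha>) + (\<Sum>\<alpha>\<in>UNIV. lower u \<alpha> * (minkowski \<alpha> \<alpha> * P \<alpha>))"
    unfolding G_def by (simp add: distrib_left sum.distrib sum_distrib_left mult_ac)
  then have G_orth: "(\<Sum>\<alpha>\<in>UNIV. lower u \<alpha> * G \<alpha>) = 0"
    by (simp add: unit A0 PQ)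
  \<comment> \<open>Contraction with the lowered \<open>u\<close> leaves \<open>-S\<close>, because
    \<open>u\<close> has norm -1 and \<open>G\<close> drops out.\<close>
  have "S = 0" if "\<forall>\<alpha>. S * u $ \<alpha> + G \<alpha> = 0"
  proof -
    have "0 = (\<Sum>\<alpha>\<in>UNIV. lower u \<alpha> * (S * u $ \<alpha> + G \<alpha>))"
      using that by simp
    also have "\<dots> = S * (\<Sum>\<alpha>\<in>UNIV. lower u \<alpha> * u $ \<alpha>) + (\<Sum>\<alpha>\<in>UNIV. lower u \<alpha> * G \<alpha>)"
      by (simp add: distrib_left sum.distrib sum_distrib_left mult_ac)
    finally show ?thesis
      by (simp add: unit G_orth)
  qed
  then have "(\<forall>\<alpha>. S * u $ \<alpha> + G \<alpha> = 0) \<longleftrightarrow> S = 0 \<and> (\<forall>\<alpha>. G \<alpha> = 0)"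
    by auto
  then show ?thesis
    unfolding E C M using pos by simp
qed

theorem proposition1:
  fixes phat rhohat :: "real \<Rightarrow> real"
    and D :: "spacetime set"
    and \<rho> p f \<nu> :: "spacetime \<Rightarrow> real"
    and U :: "spacetime \<Rightarrow> real ^ 4"
  assumes "\<And>r. r > 0 \<Longrightarrow> phat r > 0"
    and "smooth_on {0<..} phat"
    and "\<And>r. r > 0 \<Longrightarrow> deriv phat r > 0"
    and "\<And>q. q > 0 \<Longrightarrow> rhohat q > 0"
    and "\<And>q. q > 0 \<Longrightarrow> deriv rhohat q > 0"
    and "\<And>q. q > 0 \<Longrightarrow> phat (rhohat q) = q"
    and "\<And>r. r > 0 \<Longrightarrow> rhohat (phat r) = r"
    and "open D"
    and "smooth_on D \<rho>"
    and "smooth_on D U"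
    and "\<And>x. x \<in> D \<Longrightarrow> \<rho> x > 0"
    and "\<And>x. x \<in> D \<Longrightarrow> (\<Sum>\<alpha>\<in>UNIV. U x $ \<alpha> * lower (U x) \<alpha>) = -1"
    and "\<And>x. x \<in> D \<Longrightarrow> p x = phat (\<rho> x)"
    and "\<And>x. x \<in> D \<Longrightarrow> f x = lichnerowicz_index rhohat (p x)"
    and "\<And>x. x \<in> D \<Longrightarrow> \<nu> x = conjugate_index phat (\<rho> x)"
  shows "(\<forall>x\<in>D. \<forall>\<alpha>. (\<Sum>\<beta>\<in>UNIV. partial \<beta> (stress_energy \<rho> p U \<alpha> \<beta>) x) = 0) \<longleftrightarrow>
    (\<forall>x\<in>D. (\<Sum>\<beta>\<in>UNIV. partial \<beta> (\<lambda>y. \<nu> y * U y $ \<beta>) x) = 0) \<and>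
    (\<forall>x\<in>D. \<forall>\<alpha>. (\<Sum>\<beta>\<in>UNIV. U x $ \<beta> * partial \<beta> (\<lambda>y. f y * U y $ \<alpha>) x) + partial_up \<alpha> f x = 0)"
proof -
  note phat_pos = assms(1) and rhohat_pos = assms(4) and phat_rhohat = assms(6)
    and rhohat_phat = assms(7) and unit = assms(12) and p_eq = assms(13)
  have phat_deriv: "(phat has_field_derivative deriv phat r) (at r)" if "r > 0" for r
    using smooth_on_imp_has_derivative[OF assms(2)] that
    by (auto simp: DERIV_deriv_iff_real_differentiable intro: differentiableI)
  have phat_cont: "isCont phat r" if "r > 0" for r
    using phat_deriv[OF that] by (rule DERIV_isCont)
  have rhohat_cont: "isCont rhohat q" if "q > 0" for q
  proof -
    \<comment> \<open>Continuity passes from \<open>phat\<close> to its inverse. The lower end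
      \<open>rhohat q / 2\<close> keeps the neighbourhood of \<open>rhohat q\<close> inside the
      positive reals, where \<open>phat\<close> is continuous and inverted by
      \<open>rhohat\<close>.\<close>
    have "isCont rhohat (phat (rhohat q))"
    proof (rule isCont_inverse_function2[where f = phat and x = "rhohat q"
          and a = "rhohat q / 2" and b = "rhohat q + 1"])
      fix z
      assume "rhohat q / 2 \<le> z"
      then have "z > 0"
        using rhohat_pos[OF that] by linarith
      then show "rhohat (phat z) = z" and "isCont phat z"
        by (rule rhohat_phat, rule phat_cont)
    qed (use rhohat_pos[OF that] in auto)
    then show ?thesis
      using that by (simp add: phat_rhohat)
  qed
  have lich_deriv: "(lichnerowicz_index rhohat has_field_derivative
      lichnerowicz_index rhohat q * (1 / (rhohat q + q))) (at q)" if "q > 0" for q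
    unfolding lichnerowicz_index_def
  proof (rule DERIV_exp_interval_integral[OF _ that])
    show "continuous_on {0<..} (\<lambda>q. 1 / (rhohat q + q))"
      using rhohat_pos
      by (intro continuous_intros continuous_at_imp_continuous_on ballI rhohat_cont)
        (auto simp: add_pos_pos less_imp_neq[symmetric])
  qed
  have conj_deriv: "(conjugate_index phat has_field_derivative
      conjugate_index phat r * (1 / (r + phat r))) (at r)" if "r > 0" for r
    unfolding conjugate_index_def
  proof (rule DERIV_exp_interval_integral[OF _ that])
    show "continuous_on {0<..} (\<lambda>r. 1 / (r + phat r))"
      using phat_pos
      by (intro continuous_intros continuous_at_imp_continuous_on ballI phat_cont)
        (auto simp: add_pos_pos less_imp_neq[symmetric])
  qed
  \<comment> \<open>The equivalence already holds at each event separately; quantifying over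
    \<open>D\<close> comes last.\<close>
  have "(\<forall>\<alpha>. (\<Sum>\<beta>\<in>UNIV. partial \<beta> (stress_energy \<rho> p U \<alpha> \<beta>) x) = 0) \<longleftrightarrow>
      (\<Sum>\<beta>\<in>UNIV. partial \<beta> (\<lambda>y. \<nu> y * U y $ \<beta>) x) = 0 \<and>
      (\<forall>\<alpha>. (\<Sum>\<beta>\<in>UNIV. U x $ \<beta> * partial \<beta> (\<lambda>y. f y * U y $ \<alpha>) x) + partial_up \<alpha> f x = 0)"
    if x: "x \<in> D" for x
  proof -
    define h where "h = \<rho> x + p x"
    define d\<rho> where "d\<rho> = frechet_derivative \<rho> (at x)"
    define dp where "dp v = deriv phat (\<rho> x) * d\<rho> v" for v
    define dU where "dU = frechet_derivative U (at x)"
    have \<rho>_pos: "\<rho> x > 0" and p_pos: "p x > 0"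
      using x by (simp_all add: assms(11) p_eq phat_pos)
    then have h_pos: "h > 0"
      by (simp add: h_def)
    have f_pos: "f x > 0" and \<nu>_pos: "\<nu> x > 0"
      using x by (simp_all add: assms(14,15) lichnerowicz_index_def conjugate_index_def)
    have d\<rho>: "(\<rho> has_derivative d\<rho>) (at x)"
      unfolding d\<rho>_def using assms(9) x by (rule smooth_on_imp_has_derivative)
    have "(U has_derivative dU) (at x)"
      unfolding dU_def using assms(10) x by (rule smooth_on_imp_has_derivative)
    then have dU: "((\<lambda>y. U y $ \<alpha>) has_derivative (\<lambda>v. dU v $ \<alpha>)) (at x)" for \<alpha>
      by (rule bounded_linear.has_derivative[OF bounded_linear_vec_nth])
    have "((\<lambda>y. phat (\<rho> y)) has_derivative dp) (at x)"
      unfolding dp_def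
      by (rule has_derivative_compose[OF d\<rho> phat_deriv[OF \<rho>_pos, unfolded has_field_derivative_def]])
    \<comment> \<open>\<open>p\<close> is tied to \<open>\<rho>\<close> only on \<open>D\<close>. As
      \<open>D\<close> is open, the two functions agree near \<open>x\<close> and share their
      derivative; the same argument serves \<open>f\<close> and \<open>\<nu>\<close>.\<close>
    then have dp: "(p has_derivative dp) (at x)"
      by (rule has_derivative_transform_within_open[OF _ \<open>open D\<close> x]) (simp add: p_eq)
    \<comment> \<open>Since \<open>rhohat (p x)\<close> equals \<open>\<rho> x\<close>, the
      denominator \<open>rhohat q + q\<close> at \<open>q = p x\<close> is the same \<open>h\<close>
      as in the derivative of \<open>\<nu>\<close>.\<close>
    have "((\<lambda>y. lichnerowicz_index rhohat (p y)) has_derivative (\<lambda>v. f x / h * dp v)) (at x)"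
      using has_derivative_compose[OF dp lich_deriv[OF p_pos, unfolded has_field_derivative_def]]
        x \<rho>_pos by (simp add: h_def assms(14) p_eq rhohat_phat)
    then have df: "(f has_derivative (\<lambda>v. f x / h * dp v)) (at x)"
      by (rule has_derivative_transform_within_open[OF _ \<open>open D\<close> x]) (simp add: assms(14))
    have "((\<lambda>y. conjugate_index phat (\<rho> y)) has_derivative (\<lambda>v. \<nu> x / h * d\<rho> v)) (at x)"
      using has_derivative_compose[OF d\<rho> conj_deriv[OF \<rho>_pos, unfolded has_field_derivative_def]] x
      by (simp add: h_def assms(15) p_eq)
    then have d\<nu>: "(\<nu> has_derivative (\<lambda>v. \<nu> x / h * d\<rho> v)) (at x)"
      by (rule has_derivative_transform_within_open[OF _ \<open>open D\<close> x]) (simp add: assms(15))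
    define R P W where "R \<beta> = d\<rho> (axis \<beta> 1)" and "P \<beta> = dp (axis \<beta> 1)"
      and "W \<alpha> \<beta> = dU (axis \<beta> 1) $ \<alpha>" for \<alpha> \<beta> :: 4
    have E: "partial \<beta> (stress_energy \<rho> p U \<alpha> \<beta>) x = (R \<beta> + P \<beta>) * U x $ \<alpha> * U x $ \<beta>
        + h * (W \<alpha> \<beta> * U x $ \<beta> + U x $ \<alpha> * W \<beta> \<beta>) + minkowski \<alpha> \<beta> * P \<beta>" for \<alpha> \<beta>
    proof -
      \<comment> \<open>Product rule for the tensor regrouped as \<open>(\<rho> + p)\<close> times
        the product of velocities, plus \<open>p\<close> times the constant metric.\<close>
      have "(stress_energy \<rho> p U \<alpha> \<beta> has_derivative (\<lambda>v. (d\<rho> v + dp v) * U x $ \<alpha> * U x $ \<beta>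
          + h * (dU v $ \<alpha> * U x $ \<beta> + U x $ \<alpha> * dU v $ \<beta>) + minkowski \<alpha> \<beta> * dp v)) (at x)"
        unfolding stress_energy_def[abs_def] proj_def h_def
        by (auto intro!: derivative_eq_intros d\<rho> dp dU simp: algebra_simps)
      then show ?thesis
        by (simp add: partial_eq_derivative R_def P_def W_def)
    qed
    have C: "partial \<beta> (\<lambda>y. \<nu> y * U y $ \<beta>) x = \<nu> x / h * R \<beta> * U x $ \<beta> + \<nu> x * W \<beta> \<beta>" for \<beta>
      using partial_eq_derivative[OF has_derivative_mult[OF d\<nu> dU]]
      by (simp add: R_def W_def)
    have M: "partial \<beta> (\<lambda>y. f y * U y $ \<alpha>) x = f x / h * P \<beta> * U x $ \<alpha> + f x * W \<alpha> \<beta>" for \<alpha> \<beta>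
      using partial_eq_derivative[OF has_derivative_mult[OF df dU]]
      by (simp add: P_def W_def)
    have F: "partial_up \<alpha> f x = (\<Sum>\<beta>\<in>UNIV. minkowski \<alpha> \<beta> * (f x / h * P \<beta>))" for \<alpha>
      unfolding partial_up_def P_def partial_eq_derivative[OF df] ..
    have orth: "(\<Sum>\<alpha>\<in>UNIV. lower (U x) \<alpha> * W \<alpha> \<beta>) = 0" for \<beta>
    proof -
      \<comment> \<open>With the diagonal metric the norm is a signed sum of squares, whence the
        factor 2. The norm is also constant on the open set \<open>D\<close>, so uniqueness of the
        derivative forces this expression to vanish.\<close>
      have "((\<lambda>y. \<Sum>\<alpha>\<in>UNIV. U y $ \<alpha> * lower (U y) \<alpha>) has_derivative
          (\<lambda>v. 2 * (\<Sum>\<alpha>\<in>UNIV. lower (U x) \<alpha> * dU v $ \<alpha>))) (at x)"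
        unfolding lower_eq
        by (auto intro!: derivative_eq_intros dU simp: sum_distrib_left algebra_simps)
      moreover have "((\<lambda>y. \<Sum>\<alpha>\<in>UNIV. U y $ \<alpha> * lower (U y) \<alpha>) has_derivative (\<lambda>v. 0)) (at x)"
        by (rule has_derivative_transform_within_open[OF has_derivative_const \<open>open D\<close> x])
          (simp add: unit)
      ultimately have "(\<lambda>v. 2 * (\<Sum>\<alpha>\<in>UNIV. lower (U x) \<alpha> * dU v $ \<alpha>)) = (\<lambda>v. 0)"
        by (rule has_derivative_unique)
      from fun_cong[OF this, of "axis \<beta> 1"] show ?thesis
        by (simp add: W_def)
    qed
    show ?thesis
      unfolding E C M F
      by (rule euler_iff_companion_and_motion_at_event[OF _ orth h_pos f_pos \<nu>_pos])
        (use unit[OF x] in \<open>simp add: mult.commute\<close>)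
  qed
  then show ?thesis
    by blast
qed

end
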